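(* Let $m\ge3$, $n\ge2$, and let $\mathcal{A}$ be a real symmetric $m$-th order $n$-dimensional tensor. Let $S_0=\{\mathbf{x}\in\mathbb{R}^n_+:\|\mathbf{x}\|_1=1\}$ and let $\{S_1,\dots,S_r\}$ be a simplicial partition of $S_0$, where for each $k\in[r]$ the simplex $S_k$ has vertices $\mathbf{u}^k_1,\dots,\mathbf{u}^k_n$. Then: (i) if $\langle\mathcal{A},\mathbf{u}^k_{i_1}\circ\mathbf{u}^k_{i_2}\circ\cdots\circ\mathbf{u}^k_{i_m}\rangle\ge0$ for all $k\in[r]$ and all $i_1,\dots,i_m\in[n]$, then $\mathcal{A}$ is copositive; (ii) if $\langle\mathcal{A},\mathbf{u}^k_{i_1}\circ\mathbf{u}^k_{i_2}\circ\cdots\circ\mathbf{u}^k_{i_m}\rangle>0$ for all $k\in[r]$ and all $i_1,\dots,i_m\in[n]$, then $\mathcal{A}$ is strictly copositive.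
   Context: A symmetric tensor $\mathcal{A}=(a_{i_1\cdots i_m})$ has entries invariant under permutation of indices; $\langle\mathcal{A},\mathbf{x}\circ\mathbf{y}\circ\cdots\circ\mathbf{z}\rangle=\sum_{i_1,\dots,i_m}a_{i_1\cdots i_m}x_{i_1}y_{i_2}\cdots z_{i_m}$ and $\mathcal{A}\mathbf{x}^m=\langle\mathcal{A},\mathbf{x}\circ\cdots\circ\mathbf{x}\rangle$. $\mathcal{A}$ is copositive (strictly copositive) if $\mathcal{A}\mathbf{x}^m\ge0$ for all $\mathbf{x}\in\mathbb{R}^n_+$ ($\mathcal{A}\mathbf{x}^m>0$ for all $\mathbf{x}\in\mathbb{R}^n_+\setminus\{\mathbf{0}\}$). For simplices $S,S_1,\dots,S_r$ in $\mathbb{R}^n$, $\{S_1,\dots,S_r\}$ is a simplicial partition of $S$ if $S=\bigcup_{i=1}^r S_i$ and $\mathrm{int}\,S_i\cap\mathrm{int}\,S_j=\emptyset$ for $i\ne j$. *)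

theory Defs
  imports "HOL-Analysis.Analysis" "HOL-Combinatorics.Permutations"
begin

text \<open>
  An \<open>m\<close>-th order tensor whose dimension is \<open>CARD('n)\<close> is a function on multi-indices
  \<open>(i\<^sub>1, \<dots>, i\<^sub>m)\<close>, which are functions from \<open>{1..m}\<close> to \<open>'n\<close> (extensional, so that equal tuples
  are equal functions).  Values of the tensor outside \<open>multi_indices m\<close> are never used.
\<close>

type_synonym 'n tensor = "(nat \<Rightarrow> 'n) \<Rightarrow> real"

definition multi_indices :: "nat \<Rightarrow> (nat \<Rightarrow> 'n) set" where
  "multi_indices m = {1..m} \<rightarrow>\<^sub>E UNIV"

definition symmetric_tensor :: "nat \<Rightarrow> 'n tensor \<Rightarrow> bool" where
  "symmetric_tensor m A \<longleftrightarrow>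
     (\<forall>p. p permutes {1..m} \<longrightarrow> (\<forall>i\<in>multi_indices m. A (i \<circ> p) = A i))"

text \<open>\<open>tensor_inner m A x\<close> is \<open>\<langle>A, x 1 \<circ> x 2 \<circ> \<dots> \<circ> x m\<rangle>\<close>.\<close>

definition tensor_inner :: "nat \<Rightarrow> 'n::finite tensor \<Rightarrow> (nat \<Rightarrow> real ^ 'n) \<Rightarrow> real" where
  "tensor_inner m A x = (\<Sum>i\<in>multi_indices m. A i * (\<Prod>l=1..m. x l $ i l))"

definition tensor_form :: "nat \<Rightarrow> 'n::finite tensor \<Rightarrow> real ^ 'n \<Rightarrow> real" where
  "tensor_form m A x = tensor_inner m A (\<lambda>_. x)"

definition nonneg_orthant :: "(real ^ 'n) set" where
  "nonneg_orthant = {x. \<forall>i. 0 \<le> x $ i}"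

definition copositive :: "nat \<Rightarrow> 'n::finite tensor \<Rightarrow> bool" where
  "copositive m A \<longleftrightarrow> (\<forall>x\<in>nonneg_orthant. 0 \<le> tensor_form m A x)"

definition strictly_copositive :: "nat \<Rightarrow> 'n::finite tensor \<Rightarrow> bool" where
  "strictly_copositive m A \<longleftrightarrow> (\<forall>x\<in>nonneg_orthant - {0}. 0 < tensor_form m A x)"

definition norm1 :: "real ^ 'n::finite \<Rightarrow> real" where
  "norm1 x = (\<Sum>i\<in>UNIV. \<bar>x $ i\<bar>)"

definition standard_simplex :: "(real ^ 'n::finite) set" where
  "standard_simplex = {x \<in> nonneg_orthant. norm1 x = 1}"

text \<open>The dimension is a natural number, which excludes the empty \<open>(-1)\<close>-simplex.\<close>

definition is_simplex :: "'a::euclidean_space set \<Rightarrow> bool" where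
  "is_simplex S \<longleftrightarrow> (\<exists>d::nat. int d simplex S)"

text \<open>
  The vertices are enumerated without repetition by the index type; compare the definition of
  \<open>simplex\<close>.
\<close>

definition simplex_with_vertices ::
    "'a::euclidean_space set \<Rightarrow> ('i \<Rightarrow> 'a) \<Rightarrow> bool" where
  "simplex_with_vertices S v \<longleftrightarrow>
     inj v \<and> \<not> affine_dependent (range v) \<and> S = convex hull (range v)"

text \<open>
  The interior of a simplex is its relative interior: the simplices of interest lie in a
  hyperplane, so their topological interiors are empty.
\<close>

definition simplicial_partition ::
    "'a::euclidean_space set \<Rightarrow> nat \<Rightarrow> (nat \<Rightarrow> 'a set) \<Rightarrow> bool" where
  "simplicial_partition S r T \<longleftrightarrow>
     is_simplex S \<and> (\<forall>k\<in>{1..r}. is_simplex (T k)) \<and>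
     S = (\<Union>k\<in>{1..r}. T k) \<and>
     (\<forall>i\<in>{1..r}. \<forall>j\<in>{1..r}. i \<noteq> j \<longrightarrow> rel_interior (T i) \<inter> rel_interior (T j) = {})"

end

theory Submission
  imports Defs
begin

text \<open>
  At a barycentric combination of vertices, multilinearity expands the form into a combination
  of the tensor values at tuples of vertices, with products of barycentric coordinates as
  coefficients. These are nonnegative, and one of them is positive; homogeneity carries the
  sign from the standard simplex to the orthant.
\<close>

lemma finite_multi_indices [simp]: "finite (multi_indices m :: (nat \<Rightarrow> 'n::finite) set)"
  unfolding multi_indices_def by (rule finite_PiE) auto

text \<open>A product over the \<open>m\<close> slots of sums over \<open>j\<close> expands into a
  sum over all choices of one \<open>j\<close> per slot. These choices are again multi-indices, now
  over the type that enumerates the vertices, which may differ from the type of the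
  coordinates.\<close>

lemma tensor_form_sum:
  fixes A :: "'n::finite tensor" and c :: "'i::finite \<Rightarrow> real" and u :: "'i \<Rightarrow> real ^ 'n"
  shows "tensor_form m A (\<Sum>j\<in>UNIV. c j *\<^sub>R u j) =
    (\<Sum>j\<in>multi_indices m. (\<Prod>l=1..m. c (j l)) * tensor_inner m A (\<lambda>l. u (j l)))"
proof -
  have "(\<Prod>l=1..m. (\<Sum>j\<in>UNIV. c j *\<^sub>R u j) $ i l) =
      (\<Sum>j\<in>multi_indices m. \<Prod>l=1..m. c (j l) * u (j l) $ i l)" for i :: "nat \<Rightarrow> 'n"
    unfolding multi_indices_def sum_component vector_scaleR_component real_scaleR_def
    by (rule prod_sum_PiE) auto
  then show ?thesis
    unfolding tensor_form_def tensor_inner_def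
    \<comment> \<open>The swap moves the sum over coordinate multi-indices inside, where it becomes
      \<open>tensor_inner\<close> at a tuple of vertices.\<close>
    by (simp add: prod.distrib sum_distrib_left mult_ac sum.swap[of _ "multi_indices m :: (nat \<Rightarrow> 'n) set"])
qed

lemma tensor_form_scaleR: "tensor_form m A (c *\<^sub>R x) = c ^ m * tensor_form m A x"
  by (simp add: tensor_form_def tensor_inner_def prod.distrib sum_distrib_left mult_ac)

lemma simplex_with_vertices_barycentric:
  fixes v :: "'i::finite \<Rightarrow> 'a::euclidean_space"
  assumes "simplex_with_vertices S v" "x \<in> S"
  obtains c where "\<And>j. 0 \<le> c j" "sum c UNIV = 1" "x = (\<Sum>j\<in>UNIV. c j *\<^sub>R v j)"
proof -
  have inj: "inj v" and "x \<in> convex hull (range v)"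
    using assms by (auto simp: simplex_with_vertices_def)
  then obtain w where "\<forall>y\<in>range v. 0 \<le> w y" "sum w (range v) = 1"
    "(\<Sum>y\<in>range v. w y *\<^sub>R y) = x"
    by (auto simp: convex_hull_finite)
  \<comment> \<open>The weights \<open>w\<close> live on the points of the hull's generating set;
    injectivity of \<open>v\<close> turns them into weights on indices.\<close>
  then show thesis
    by (intro that[of "w \<circ> v"]) (auto simp: sum.reindex[OF inj] o_def)
qed

lemma tensor_form_nonneg_on_simplex:
  fixes A :: "'n::finite tensor" and u :: "'i::finite \<Rightarrow> real ^ 'n"
  assumes "simplex_with_vertices S u" "x \<in> S"
    and "\<And>i. i \<in> multi_indices m \<Longrightarrow> 0 \<le> tensor_inner m A (\<lambda>l. u (i l))"
  shows "0 \<le> tensor_form m A x"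
proof -
  obtain c where "\<And>j. 0 \<le> c j" and x: "x = (\<Sum>j\<in>UNIV. c j *\<^sub>R u j)"
    using simplex_with_vertices_barycentric[OF assms(1,2)] by metis
  then show ?thesis
    unfolding x tensor_form_sum using assms(3) by (intro sum_nonneg mult_nonneg_nonneg prod_nonneg) auto
qed

text \<open>Weights summing to 1 cannot all vanish. If \<open>c k\<close> is positive, the
  multi-index constantly \<open>k\<close> contributes \<open>c k ^ m\<close> times a positive value,
  and no other term is negative.\<close>

lemma tensor_form_pos_on_simplex:
  fixes A :: "'n::finite tensor" and u :: "'i::finite \<Rightarrow> real ^ 'n"
  assumes "simplex_with_vertices S u" "x \<in> S"
    and pos: "\<And>i. i \<in> multi_indices m \<Longrightarrow> 0 < tensor_inner m A (\<lambda>l. u (i l))"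
  shows "0 < tensor_form m A x"
proof -
  obtain c where c: "\<And>j. 0 \<le> c j" "sum c UNIV = 1" and x: "x = (\<Sum>j\<in>UNIV. c j *\<^sub>R u j)"
    using simplex_with_vertices_barycentric[OF assms(1,2)] by metis
  obtain k where "c k \<noteq> 0"
    using c(2) by (metis sum.neutral zero_neq_one)
  then have k: "0 < c k"
    using c(1)[of k] by simp
  \<comment> \<open>Multi-indices are extensional, so the constant function has to be restricted to
    the slots.\<close>
  define i where "i = restrict (\<lambda>_. k) {1..m}"
  have i: "i \<in> multi_indices m"
    by (auto simp: i_def multi_indices_def)
  have "0 < (\<Prod>l=1..m. c (i l))"
    using k by (intro prod_pos) (auto simp: i_def)
  then show ?thesis
    unfolding x tensor_form_sum
    using i pos by (intro sum_pos2[where i = i] mult_pos_pos mult_nonneg_nonneg prod_nonneg)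
      (auto simp: c(1) intro: less_imp_le)
qed

lemma nonneg_orthant_scale_standard_simplex:
  fixes x :: "real ^ 'n::finite"
  assumes "x \<in> nonneg_orthant" "x \<noteq> 0"
  obtains c y where "0 < c" "y \<in> standard_simplex" "x = c *\<^sub>R y"
proof -
  obtain k where "x $ k \<noteq> 0"
    using assms(2) by (auto simp: vec_eq_iff)
  then have pos: "0 < norm1 x"
    unfolding norm1_def by (intro sum_pos2[where i = k]) auto
  \<comment> \<open>Only the norm of the scaled vector is unfolded; the norm in the scaling factor
    stays intact.\<close>
  have "norm1 (inverse (norm1 x) *\<^sub>R x) = inverse (norm1 x) * norm1 x"
    using pos by (simp add: norm1_def[of "_ *\<^sub>R _"] abs_mult flip: sum_distrib_left norm1_def)
  then have "inverse (norm1 x) *\<^sub>R x \<in> standard_simplex"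
    using assms(1) pos by (auto simp: standard_simplex_def nonneg_orthant_def)
  with pos show thesis
    by (intro that[of "norm1 x" "inverse (norm1 x) *\<^sub>R x"]) auto
qed

lemma strictly_copositiveI:
  fixes A :: "'n::finite tensor"
  assumes "\<And>x. x \<in> standard_simplex \<Longrightarrow> 0 < tensor_form m A x"
  shows "strictly_copositive m A"
  unfolding strictly_copositive_def
proof
  fix x :: "real ^ 'n"
  assume "x \<in> nonneg_orthant - {0}"
  then obtain c y where "0 < c" "y \<in> standard_simplex" "x = c *\<^sub>R y"
    using nonneg_orthant_scale_standard_simplex[of x] by auto
  then show "0 < tensor_form m A x"
    using assms by (simp add: tensor_form_scaleR)
qed

text \<open>Unlike strict copositivity, copositivity also concerns the origin, which is no multiple
  of a point of the simplex by a positive factor and is treated separately.\<close>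

lemma copositiveI:
  fixes A :: "'n::finite tensor"
  assumes "m > 0" "\<And>x. x \<in> standard_simplex \<Longrightarrow> 0 \<le> tensor_form m A x"
  shows "copositive m A"
  unfolding copositive_def
proof
  fix x :: "real ^ 'n"
  assume x: "x \<in> nonneg_orthant"
  show "0 \<le> tensor_form m A x"
  proof (cases "x = 0")
    case True
    then show ?thesis
      \<comment> \<open>Homogeneity with factor 0 gives the value \<open>0 ^ m\<close>, times the
        form, which is 0 because \<open>m\<close> is positive.\<close>
      using tensor_form_scaleR[of m A 0 x] assms(1) by (simp add: power_0_left)
  next
    case False
    then obtain c y where "0 < c" "y \<in> standard_simplex" "x = c *\<^sub>R y"
      using nonneg_orthant_scale_standard_simplex[OF x] by auto
    then show ?thesis
      using assms(2) by (simp add: tensor_form_scaleR)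
  qed
qed

theorem theorem4p1:
  fixes A :: "'n::finite tensor"
    and m r :: nat
    and S :: "nat \<Rightarrow> (real ^ 'n) set"
    and u :: "nat \<Rightarrow> 'n \<Rightarrow> real ^ 'n"
  assumes "m \<ge> 3"
    and "CARD('n) \<ge> 2"
    and "symmetric_tensor m A"
    and "simplicial_partition (standard_simplex :: (real ^ 'n) set) r S"
    and "\<And>k. k \<in> {1..r} \<Longrightarrow> simplex_with_vertices (S k) (u k)"
  shows "((\<forall>k\<in>{1..r}. \<forall>i\<in>multi_indices m. tensor_inner m A (\<lambda>l. u k (i l)) \<ge> 0)
            \<longrightarrow> copositive m A)
       \<and> ((\<forall>k\<in>{1..r}. \<forall>i\<in>multi_indices m. tensor_inner m A (\<lambda>l. u k (i l)) > 0)
            \<longrightarrow> strictly_copositive m A)"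
proof (intro conjI impI)
  \<comment> \<open>Covering reduces both claims to a single piece, where the signs at its vertex
    tuples decide.\<close>
  have cover: "\<exists>k\<in>{1..r}. x \<in> S k" if "x \<in> standard_simplex" for x
    using assms(4) that by (auto simp: simplicial_partition_def)
  {
    assume "\<forall>k\<in>{1..r}. \<forall>i\<in>multi_indices m. tensor_inner m A (\<lambda>l. u k (i l)) \<ge> 0"
    then have "0 \<le> tensor_form m A x" if "x \<in> standard_simplex" for x
      using cover[OF that] assms(5) tensor_form_nonneg_on_simplex by metis
    then show "copositive m A"
      using assms(1) by (intro copositiveI) auto
  next
    assume "\<forall>k\<in>{1..r}. \<forall>i\<in>multi_indices m. tensor_inner m A (\<lambda>l. u k (i l)) > 0"
    then have "0 < tensor_form m A x" if "x \<in> standard_simplex" for x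
      using cover[OF that] assms(5) tensor_form_pos_on_simplex by metis
    then show "strictly_copositive m A"
      by (rule strictly_copositiveI)
  }
qed

end
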